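(* Let $K$ be an arbitrary complex Hilbert space. An element $T=\begin{bmatrix} BU & CV\\ C^*U & EV\end{bmatrix}\in\mathcal G$ is normal (as an operator on the Hilbert space $H\oplus K$) if and only if $UB=BU$, $UC=CV$ and $VE=EV$.
   Context: $H$ and $K$ are complex Hilbert spaces (of arbitrary, finite or infinite, but different Hilbert dimensions). $B(K,H)$ is the Banach space of bounded linear operators $K\to H$ with the operator norm, $\mathcal B$ its open unit ball, and $U(H)$, $U(K)$ the unitary groups. $\mathcal G$ is the group of all bijective linear operators on $H\oplus K$ that preserve the Hermitian form $\mathcal S((h_1,k_1),(h_2,k_2))=\langle h_1,h_2\rangle-\langle k_1,k_2\rangle$. Every $T\in\mathcal G$ is written as $T=\begin{bmatrix} BU & CV\\ C^*U & EV\end{bmatrix}$ with $U\in U(H)$, $V\in U(K)$, $B=(I-AA^* )^{-1/2}$, $C=(I-AA^* )^{-1/2}A$, $E=(I-A^*A)^{-1/2}$ for some $A\in\mathcal B$; in particular $B,E$ are positive invertible, $B^2-CC^*=I$, $E^2-C^*C=I$ and $BC=CE$. *)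

theory Defs
  imports "HOL-Analysis.Analysis" "HOL-Library.Equipollence"
begin

text \<open>
  Complex inner product spaces and Hilbert spaces as type classes over the topological and
  normed structure of \<^class>\<open>real_normed_vector\<close>. The inner product is linear in its first
  argument. Positive definiteness is contained in the last axiom, since the norm is definite.
\<close>

class complex_inner = real_normed_vector +
  fixes scaleC :: "complex \<Rightarrow> 'a \<Rightarrow> 'a" (infixr \<open>*\<^sub>C\<close> 75)
    and cinner :: "'a \<Rightarrow> 'a \<Rightarrow> complex"
  assumes scaleC_add_right: "c *\<^sub>C (x + y) = c *\<^sub>C x + c *\<^sub>C y"
    and scaleC_add_left: "(c + d) *\<^sub>C x = c *\<^sub>C x + d *\<^sub>C x"
    and scaleC_scaleC: "c *\<^sub>C d *\<^sub>C x = (c * d) *\<^sub>C x"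
    and scaleR_scaleC: "r *\<^sub>R x = complex_of_real r *\<^sub>C x"
    and cinner_add_left: "cinner (x + y) z = cinner x z + cinner y z"
    and cinner_scaleC_left: "cinner (c *\<^sub>C x) y = c * cinner x y"
    and cinner_commute: "cinner x y = cnj (cinner y x)"
    and cinner_self: "cinner x x = complex_of_real ((norm x)\<^sup>2)"

class complex_hilbert_space = complex_inner + complete_space

lemma vector_space_scaleC: "vector_space (scaleC :: complex \<Rightarrow> 'a::complex_inner \<Rightarrow> 'a)"
proof
  fix x :: 'a
  show "1 *\<^sub>C x = x"
    using scaleR_scaleC[of 1 x] by simp
qed (simp_all add: scaleC_add_right scaleC_add_left scaleC_scaleC)

instantiation complex :: complex_hilbert_space
begin

definition scaleC_complex :: "complex \<Rightarrow> complex \<Rightarrow> complex" where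
  "scaleC_complex c x = c * x"

definition cinner_complex :: "complex \<Rightarrow> complex \<Rightarrow> complex" where
  "cinner_complex x y = x * cnj y"

instance
  by standard
    (auto simp: scaleC_complex_def cinner_complex_def algebra_simps scaleR_conv_of_real
      complex_norm_square simp del: of_real_power)

end

text \<open>
  The Hilbert space direct sum of \<open>H\<close> and \<open>K\<close> is the product type: its library norm is
  already the Hilbert norm \<open>sqrt ((norm h)\<^sup>2 + (norm k)\<^sup>2)\<close>.
\<close>

instantiation prod :: (complex_inner, complex_inner) complex_inner
begin

definition scaleC_prod :: "complex \<Rightarrow> 'a \<times> 'b \<Rightarrow> 'a \<times> 'b" where
  "scaleC_prod c x = (c *\<^sub>C fst x, c *\<^sub>C snd x)"

definition cinner_prod :: "'a \<times> 'b \<Rightarrow> 'a \<times> 'b \<Rightarrow> complex" where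
  "cinner_prod x y = cinner (fst x) (fst y) + cinner (snd x) (snd y)"

instance
proof
  fix x y :: "'a \<times> 'b"
  show "cinner x y = cnj (cinner y x)"
    unfolding cinner_prod_def
    using cinner_commute[of "fst x" "fst y"] cinner_commute[of "snd x" "snd y"] by simp
  show "cinner x x = complex_of_real ((norm x)\<^sup>2)"
    by (simp add: cinner_prod_def cinner_self norm_prod_def del: of_real_power)
qed (auto simp: scaleC_prod_def cinner_prod_def scaleC_add_right scaleC_add_left scaleC_scaleC
    scaleR_scaleC cinner_add_left cinner_scaleC_left scaleR_prod_def algebra_simps)

end

instance prod :: (complex_hilbert_space, complex_hilbert_space) complex_hilbert_space ..

definition orthonormal_basis :: "'a::complex_hilbert_space set \<Rightarrow> bool" where
  "orthonormal_basis M \<longleftrightarrow>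
     (\<forall>x\<in>M. norm x = 1) \<and>
     (\<forall>x\<in>M. \<forall>y\<in>M. x \<noteq> y \<longrightarrow> cinner x y = 0) \<and>
     closure (module.span scaleC M) = UNIV"

definition clinear :: "('a::complex_inner \<Rightarrow> 'b::complex_inner) \<Rightarrow> bool" where
  "clinear f \<longleftrightarrow> Vector_Spaces.linear scaleC scaleC f"

definition bounded_clinear :: "('a::complex_inner \<Rightarrow> 'b::complex_inner) \<Rightarrow> bool" where
  "bounded_clinear f \<longleftrightarrow> clinear f \<and> bounded_linear f"

definition operator_ball :: "('a::complex_inner \<Rightarrow> 'b::complex_inner) set" where
  "operator_ball = {A. bounded_clinear A \<and> onorm A < 1}"

definition cadjoint ::
  "('a::complex_hilbert_space \<Rightarrow> 'b::complex_hilbert_space) \<Rightarrow> 'b \<Rightarrow> 'a" where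
  "cadjoint f = (THE g. \<forall>x y. cinner (f x) y = cinner x (g y))"

definition normal_op :: "('a::complex_hilbert_space \<Rightarrow> 'a) \<Rightarrow> bool" where
  "normal_op T \<longleftrightarrow> bounded_clinear T \<and> T \<circ> cadjoint T = cadjoint T \<circ> T"

definition unitary_group :: "('a::complex_hilbert_space \<Rightarrow> 'a) set" where
  "unitary_group = {U. bounded_clinear U \<and> cadjoint U \<circ> U = id \<and> U \<circ> cadjoint U = id}"

definition positive_op :: "('a::complex_hilbert_space \<Rightarrow> 'a) \<Rightarrow> bool" where
  "positive_op P \<longleftrightarrow> bounded_clinear P \<and> (\<forall>x. cinner (P x) x \<in> \<real>\<^sub>\<ge>\<^sub>0)"

definition op_sqrt :: "('a::complex_hilbert_space \<Rightarrow> 'a) \<Rightarrow> 'a \<Rightarrow> 'a" where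
  "op_sqrt P = (THE Q. positive_op Q \<and> Q \<circ> Q = P)"

definition op_inv_sqrt :: "('a::complex_hilbert_space \<Rightarrow> 'a) \<Rightarrow> 'a \<Rightarrow> 'a" where
  "op_inv_sqrt P = inv (op_sqrt P)"

definition indefinite_form ::
  "'h::complex_hilbert_space \<times> 'k::complex_hilbert_space \<Rightarrow> 'h \<times> 'k \<Rightarrow> complex" where
  "indefinite_form x y = cinner (fst x) (fst y) - cinner (snd x) (snd y)"

definition form_group ::
  "('h::complex_hilbert_space \<times> 'k::complex_hilbert_space \<Rightarrow> 'h \<times> 'k) set" where
  "form_group = {T. clinear T \<and> bij T \<and>
     (\<forall>x y. indefinite_form (T x) (T y) = indefinite_form x y)}"

definition block_op ::
  "('h \<Rightarrow> 'h) \<Rightarrow> ('k \<Rightarrow> 'h) \<Rightarrow> ('h \<Rightarrow> 'k) \<Rightarrow> ('k \<Rightarrow> 'k)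
    \<Rightarrow> 'h::complex_hilbert_space \<times> 'k::complex_hilbert_space \<Rightarrow> 'h \<times> 'k" where
  "block_op T11 T12 T21 T22 = (\<lambda>(h, k). (T11 h + T12 k, T21 h + T22 k))"

end

theory Submission
  imports Defs
begin

text \<open>
  On \<open>H \<oplus> K\<close> put \<open>N = [[0, A], [A\<^sup>*, 0]]\<close>, \<open>W = U \<oplus> V\<close> and \<open>Q = (I - N\<^sup>2)\<^sup>1\<^sup>/\<^sup>2\<close>. Then
  \<open>T = P W\<close> with the self-adjoint \<open>P = (I + N) Q\<^sup>-\<^sup>1\<close>, so \<open>T\<close> is normal iff \<open>W\<close> commutes with
  \<open>P\<^sup>2 = (I + N) (I - N)\<^sup>-\<^sup>1\<close>. Inverting this Cayley transform, \<open>W\<close> then commutes with \<open>N\<close>, hence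
  with \<open>Q\<close>, which lies in the bicommutant of \<open>N\<^sup>2\<close>, hence with \<open>P\<close>; read off in blocks, this is the
  claim. The square root is \<open>I - Y\<close>, where \<open>Y\<close> is the fixed point of the contraction
  \<open>Y \<mapsto> (X + Y\<^sup>2) / 2\<close> for \<open>X = N\<^sup>2\<close>.
\<close>

section \<open>Complex inner products\<close>

instance complex_hilbert_space \<subseteq> banach ..

lemma cinner_add_right: "cinner x (y + z) = cinner x y + cinner x z"
  using cinner_commute[of x "y + z"] cinner_commute[of x y] cinner_commute[of x z]
  by (simp add: cinner_add_left)

lemma cinner_scaleC_right: "cinner x (c *\<^sub>C y) = cnj c * cinner x y"
  using cinner_commute[of x "c *\<^sub>C y"] cinner_commute[of x y]
  by (simp add: cinner_scaleC_left)

lemma cinner_scaleR_left: "cinner (r *\<^sub>R x) y = of_real r * cinner x y"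
  by (simp add: scaleR_scaleC cinner_scaleC_left)

lemma cinner_scaleR_right: "cinner x (r *\<^sub>R y) = of_real r * cinner x y"
  by (simp add: scaleR_scaleC cinner_scaleC_right)

lemma cinner_minus_left: "cinner (- x) y = - cinner x y"
  using cinner_scaleR_left[of "-1" x y] by simp

lemma cinner_minus_right: "cinner x (- y) = - cinner x y"
  using cinner_scaleR_right[of x "-1" y] by simp

lemma cinner_diff_left: "cinner (x - y) z = cinner x z - cinner y z"
  using cinner_add_left[of x "- y" z] by (simp add: cinner_minus_left)

lemma cinner_diff_right: "cinner x (y - z) = cinner x y - cinner x z"
  using cinner_add_right[of x y "- z"] by (simp add: cinner_minus_right)

lemma cinner_zero_left [simp]: "cinner 0 y = 0"
  using cinner_scaleR_left[of 0 0 y] by simp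

lemma cinner_zero_right [simp]: "cinner x 0 = 0"
  using cinner_scaleR_right[of x 0 0] by simp

lemmas cinner_linear = cinner_add_left cinner_add_right cinner_diff_left cinner_diff_right
  cinner_scaleR_left cinner_scaleR_right

lemma Re_cinner_commute: "Re (cinner x y) = Re (cinner y x)"
  using cinner_commute[of x y] by simp

lemma norm_add_sq: "(norm (x + y))\<^sup>2 = (norm x)\<^sup>2 + (norm y)\<^sup>2 + 2 * Re (cinner x y)"
  for x y :: "'a::complex_inner"
proof -
  have "Re (cinner (x + y) (x + y)) = Re (cinner x x) + Re (cinner y y) + 2 * Re (cinner x y)"
    using Re_cinner_commute[of x y] by (simp add: cinner_linear)
  then show ?thesis by (simp add: cinner_self del: of_real_power)
qed

text \<open>The triangle inequality belongs to the norm axioms; squaring it and expanding both sides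
  leaves Cauchy-Schwarz for the real part.\<close>

lemma Re_cinner_le: "Re (cinner x y) \<le> norm x * norm y"
proof -
  have "(norm (x + y))\<^sup>2 \<le> (norm x + norm y)\<^sup>2"
    by (simp add: norm_triangle_ineq power_mono)
  then show ?thesis by (simp add: norm_add_sq power2_sum)
qed

lemma norm_scaleC: "norm (c *\<^sub>C x) = cmod c * norm x"
proof -
  have "cinner (c *\<^sub>C x) (c *\<^sub>C x) = c * cnj c * cinner x x"
    by (simp add: cinner_scaleC_left cinner_scaleC_right)
  then have "complex_of_real ((norm (c *\<^sub>C x))\<^sup>2) = of_real ((cmod c)\<^sup>2 * (norm x)\<^sup>2)"
    by (simp only: cinner_self complex_norm_square[symmetric] of_real_mult)
  then have "(norm (c *\<^sub>C x))\<^sup>2 = (cmod c * norm x)\<^sup>2"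
    by (simp only: of_real_eq_iff power_mult_distrib)
  then show ?thesis by simp
qed

lemma norm_cinner_le: "cmod (cinner x y) \<le> norm x * norm y"
proof (cases "cinner x y = 0")
  case False
  \<comment> \<open>A unimodular factor that rotates \<open>cinner x y\<close> onto its modulus,
    which reduces the claim to the real part.\<close>
  define c where "c = cnj (cinner x y) / cmod (cinner x y)"
  have "cmod c = 1" using False by (simp add: c_def norm_divide)
  have "c * cinner x y = (cinner x y * cnj (cinner x y)) / cmod (cinner x y)"
    by (simp add: c_def)
  also have "\<dots> = cmod (cinner x y)"
    using False by (simp add: complex_norm_square[symmetric] power2_eq_square)
  finally have "Re (cinner (c *\<^sub>C x) y) = cmod (cinner x y)"
    by (simp add: cinner_scaleC_left)
  then show ?thesis
    using Re_cinner_le[of "c *\<^sub>C x" y] \<open>cmod c = 1\<close> by (simp add: norm_scaleC)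
qed simp

lemma bounded_linear_cinner_left: "bounded_linear (\<lambda>x. cinner x y)"
  by (rule bounded_linear_intro[where K = "norm y"])
    (simp_all add: cinner_linear norm_cinner_le scaleR_conv_of_real)

lemma bounded_linear_cinner_right: "bounded_linear (cinner x)"
  by (rule bounded_linear_intro[where K = "norm x"])
    (use norm_cinner_le[of x] in \<open>simp_all add: cinner_linear scaleR_conv_of_real mult.commute\<close>)

lemma cinner_eqI: "(\<And>x. cinner x y = cinner x z) \<Longrightarrow> y = z"
  using cinner_self[of "y - z"] by (simp add: cinner_diff_right)

lemma clinear_iff:
  "clinear f \<longleftrightarrow> (\<forall>x y. f (x + y) = f x + f y) \<and> (\<forall>c x. f (c *\<^sub>C x) = c *\<^sub>C f x)"
  unfolding clinear_def Vector_Spaces.linear_iff by (simp add: vector_space_scaleC)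

section \<open>Adjoints\<close>

text \<open>The representing vector minimises \<open>\<parallel>x\<parallel>\<^sup>2 - 2 f x\<close>.\<close>

lemma riesz_representation:
  fixes f :: "'a::complex_hilbert_space \<Rightarrow> real"
  assumes f: "bounded_linear f"
  obtains z where "\<And>x. f x = Re (cinner x z)"
proof -
  interpret f: bounded_linear f by fact
  define J where "J x = (norm x)\<^sup>2 - 2 * f x" for x
  obtain K where K: "\<And>x. norm (f x) \<le> norm x * K" using f.bounded by blast
  have "J x \<ge> - K\<^sup>2" for x
  proof -
    have "f x \<le> norm x * K" using K[of x] by simp
    moreover have "0 \<le> (norm x - K)\<^sup>2" by simp
    ultimately show ?thesis by (simp add: J_def power2_diff)
  qed
  then have bdd: "bdd_below (range J)" by (intro bdd_belowI2)
  define m where "m = Inf (range J)"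
  have m_le: "m \<le> J x" for x unfolding m_def by (rule cInf_lower) (use bdd in auto)
  have "\<exists>x. J x < m + 1 / Suc n" for n
    using cInf_lessD[of "range J" "m + 1 / Suc n"] by (auto simp: m_def)
  then obtain s where s: "\<And>n. J (s n) < m + 1 / Suc n" by metis
  \<comment> \<open>Parallelogram law: the linear terms of \<open>J\<close> cancel against those at
    the midpoint, so near-minimisers are close to each other.\<close>
  have par: "(norm (x - y))\<^sup>2 = 2 * J x + 2 * J y - 4 * J ((1/2) *\<^sub>R (x + y))" for x y
  proof -
    have "(norm (x - y))\<^sup>2 = (norm x)\<^sup>2 + (norm y)\<^sup>2 - 2 * Re (cinner x y)"
      using norm_add_sq[of x "- y"] by (simp add: cinner_minus_right)
    moreover have "(norm ((1/2) *\<^sub>R (x + y)))\<^sup>2 = (norm (x + y))\<^sup>2 / 4"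
      by (simp add: power_divide)
    ultimately show ?thesis
      unfolding J_def norm_add_sq f.scaleR f.add by (simp add: field_simps)
  qed
  have "Cauchy s"
  proof (rule CauchyI)
    fix e :: real assume "0 < e"
    \<comment> \<open>The 4 arises because \<open>par\<close> counts two values of \<open>J\<close>
      with weight 2, each exceeding \<open>m\<close> by less than \<open>1 / Suc M\<close>, while
      the midpoint has \<open>J\<close> at least \<open>m\<close>.\<close>
    then obtain M where M: "4 / Suc M < e\<^sup>2"
      using reals_Archimedean[of "e\<^sup>2 / 4"] by (auto simp: field_simps)
    have "norm (s i - s j) < e" if "i \<ge> M" "j \<ge> M" for i j
    proof -
      have "1 / real (Suc i) \<le> 1 / Suc M" "1 / real (Suc j) \<le> 1 / Suc M"
        using that by (auto simp: frac_le)
      then have "(norm (s i - s j))\<^sup>2 < 4 / Suc M"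
        using par[of "s i" "s j"] s[of i] s[of j] m_le[of "(1/2) *\<^sub>R (s i + s j)"] by simp
      with M have "(norm (s i - s j))\<^sup>2 < e\<^sup>2" by simp
      then show ?thesis using \<open>0 < e\<close> by (simp add: power2_less_imp_less)
    qed
    then show "\<exists>M. \<forall>i\<ge>M. \<forall>j\<ge>M. norm (s i - s j) < e" by blast
  qed
  then obtain z where z: "s \<longlonglongrightarrow> z" using Cauchy_convergent_iff convergent_def by blast
  have "(\<lambda>n. J (s n)) \<longlonglongrightarrow> J z"
    unfolding J_def by (intro tendsto_intros f.tendsto z)
  moreover have "(\<lambda>n. m + 1 / Suc n) \<longlonglongrightarrow> m + 0"
    by (intro tendsto_intros LIMSEQ_Suc[OF lim_1_over_n])
  ultimately have "J z \<le> m"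
    using LIMSEQ_le[of "\<lambda>n. J (s n)" "J z" "\<lambda>n. m + 1 / Suc n" m] s by (auto intro: less_imp_le)
  have "f v = Re (cinner v z)" for v
  proof (cases "v = 0")
    case False
    \<comment> \<open>\<open>2 * c\<close> is the derivative of \<open>J\<close> at \<open>z\<close>
      along \<open>v\<close>, and \<open>t\<close> minimises the resulting quadratic; minimality of
      \<open>J z\<close> then forces \<open>c = 0\<close>.\<close>
    define c where "c = Re (cinner z v) - f v"
    define t where "t = - c / (norm v)\<^sup>2"
    have "J (z + t *\<^sub>R v) = J z + t\<^sup>2 * (norm v)\<^sup>2 + 2 * t * c"
      by (simp add: J_def norm_add_sq f.add f.scaleR cinner_scaleR_right c_def
          power_mult_distrib algebra_simps)
    then have "0 \<le> t\<^sup>2 * (norm v)\<^sup>2 + 2 * t * c"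
      using m_le[of "z + t *\<^sub>R v"] \<open>J z \<le> m\<close> by simp
    also have "\<dots> = - (c\<^sup>2 / (norm v)\<^sup>2)"
      using False by (simp add: t_def field_simps power2_eq_square)
    finally have "c = 0" using False by (simp add: divide_le_0_iff)
    then show ?thesis using Re_cinner_commute[of z v] by (simp add: c_def)
  qed (simp add: f.zero)
  then show thesis by (rule that)
qed

text \<open>A relational form of the adjoint: an explicit candidate can be verified directly, and
  the definite description in \<open>cadjoint\<close> is then evaluated by uniqueness.\<close>

definition adjoint_pair ::
  "('a::complex_hilbert_space \<Rightarrow> 'b::complex_hilbert_space) \<Rightarrow> ('b \<Rightarrow> 'a) \<Rightarrow> bool" where
  "adjoint_pair f g \<longleftrightarrow> (\<forall>x y. cinner (f x) y = cinner x (g y))"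

lemma adjoint_pairD: "adjoint_pair f g \<Longrightarrow> cinner (f x) y = cinner x (g y)"
  by (simp add: adjoint_pair_def)

lemma adjoint_pair_sym: "adjoint_pair f g \<Longrightarrow> adjoint_pair g f"
  unfolding adjoint_pair_def
  by (simp add: cinner_commute[of "g _"] cinner_commute[of _ "f _"])

lemma cadjoint_eqI:
  assumes "adjoint_pair f g"
  shows "cadjoint f = g"
  unfolding cadjoint_def
proof (rule the_equality)
  fix g' assume g': "\<forall>x y. cinner (f x) y = cinner x (g' y)"
  show "g' = g"
  proof
    fix y
    have "cinner x (g' y) = cinner x (g y)" for x
      using g' adjoint_pairD[OF assms, of x y] by simp
    then show "g' y = g y" by (rule cinner_eqI)
  qed
qed (use assms in \<open>simp add: adjoint_pair_def\<close>)

text \<open>Vectors are determined by their inner products, so the pairing alone forces additivity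
  and homogeneity.\<close>

lemma adjoint_pair_clinear_right:
  assumes "adjoint_pair f g"
  shows "clinear g"
  unfolding clinear_iff
  by (intro conjI allI; rule cinner_eqI)
    (simp_all add: adjoint_pairD[OF assms, symmetric] cinner_add_right cinner_scaleC_right)

lemma adjoint_pair_clinear: "adjoint_pair f g \<Longrightarrow> clinear f"
  using adjoint_pair_clinear_right adjoint_pair_sym by blast

lemma bounded_clinearI:
  assumes "clinear f" "\<And>x. norm (f x) \<le> q * norm x"
  shows "bounded_clinear f"
  unfolding bounded_clinear_def
proof
  show "bounded_linear f"
    by (rule bounded_linear_intro[where K = q])
      (use assms in \<open>simp_all add: clinear_iff scaleR_scaleC mult.commute\<close>)
qed fact

lemma adjoint_pair_comp:
  "adjoint_pair f f' \<Longrightarrow> adjoint_pair g g' \<Longrightarrow> adjoint_pair (f \<circ> g) (g' \<circ> f')"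
  by (simp add: adjoint_pair_def)

lemma adjoint_pair_map_prod:
  "adjoint_pair f f' \<Longrightarrow> adjoint_pair g g' \<Longrightarrow> adjoint_pair (map_prod f g) (map_prod f' g')"
  by (simp add: adjoint_pair_def cinner_prod_def)

text \<open>Existence of the adjoint: for each \<open>y\<close>, the Riesz lemma represents the real
  part of \<open>cinner (f x) y\<close> as a functional of \<open>x\<close>.\<close>

lemma adjoint_pair_cadjoint:
  assumes f: "bounded_clinear f"
  shows "adjoint_pair f (cadjoint f)"
proof -
  have bl: "bounded_linear f" and cl: "\<And>c x. f (c *\<^sub>C x) = c *\<^sub>C f x"
    using f by (simp_all add: bounded_clinear_def clinear_iff)
  have "\<exists>z. \<forall>x. cinner (f x) y = cinner x z" for y
  proof -
    have "bounded_linear (\<lambda>x. Re (cinner (f x) y))"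
      by (intro bounded_linear_compose[OF bounded_linear_Re]
          bounded_linear_compose[OF bounded_linear_cinner_left] bl)
    then obtain z where z: "\<And>x. Re (cinner (f x) y) = Re (cinner x z)"
      using riesz_representation by blast
    \<comment> \<open>Only real parts agree so far; evaluating at \<open>\<i> *\<^sub>C x\<close>
      recovers the imaginary parts.\<close>
    have "cinner (f x) y = cinner x z" for x
      using z[of x] z[of "\<i> *\<^sub>C x"] by (simp add: cl cinner_scaleC_left complex_eq_iff)
    then show ?thesis by blast
  qed
  then obtain g where "adjoint_pair f g" unfolding adjoint_pair_def by metis
  then show ?thesis using cadjoint_eqI by metis
qed

text \<open>Pairing \<open>f (g y)\<close> with \<open>y\<close> bounds the square of
  \<open>norm (g y)\<close> by \<open>q * norm (g y) * norm y\<close>; then one factor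
  cancels.\<close>

lemma adjoint_pair_norm_le:
  assumes fg: "adjoint_pair f g" and f: "\<And>x. norm (f x) \<le> q * norm x" and "0 \<le> q"
  shows "norm (g y) \<le> q * norm y"
proof (cases "g y = 0")
  case False
  have "(norm (g y))\<^sup>2 = Re (cinner (f (g y)) y)"
    by (simp add: adjoint_pairD[OF fg] cinner_self del: of_real_power)
  also have "\<dots> \<le> q * norm (g y) * norm y"
    using Re_cinner_le[of "f (g y)" y] mult_right_mono[OF f[of "g y"], of "norm y"] by simp
  finally have "norm (g y) * norm (g y) \<le> norm (g y) * (q * norm y)"
    by (simp add: power2_eq_square ac_simps)
  then show ?thesis using False by simp
qed (use \<open>0 \<le> q\<close> in simp)

section \<open>Square roots of strictly positive operators\<close>

text \<open>Solving \<open>x - Y x = y\<close> means finding a fixed point of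
  \<open>x \<mapsto> y + Y x\<close>, to which Banach's theorem applies.\<close>

lemma bij_id_minus_contraction:
  fixes Y :: "'a::banach \<Rightarrow> 'a"
  assumes "bounded_linear Y" and le: "\<And>x. norm (Y x) \<le> q * norm x" and "0 \<le> q" "q < 1"
  shows "bij (\<lambda>x. x - Y x)"
proof -
  interpret Y: bounded_linear Y by fact
  have "\<exists>!x. y + Y x = x" for y
  proof (rule banach_fix_type[OF \<open>0 \<le> q\<close> \<open>q < 1\<close>], intro allI)
    show "dist (y + Y x) (y + Y z) \<le> q * dist x z" for x z
      using le[of "x - z"] by (simp add: dist_norm Y.diff)
  qed
  then show ?thesis unfolding bij_iff by (simp add: algebra_simps eq_commute)
qed

text \<open>The third conclusion says that \<open>I - Y\<close> squares to \<open>I - X\<close>. The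
  other properties are built into a closed set that the iteration preserves, so its fixed point
  inherits them.\<close>

lemma contraction_fixed_point:
  fixes X :: "'a::complex_hilbert_space \<Rightarrow> 'a"
  assumes X: "adjoint_pair X X" and le: "\<And>x. norm (X x) \<le> q * norm x" and q: "0 \<le> q" "q < 1"
  obtains Y where "adjoint_pair Y Y" "\<And>x. norm (Y x) \<le> q * norm x"
    "\<And>x. 2 *\<^sub>R Y x = X x + Y (Y x)"
    "\<And>M x. bounded_linear M \<Longrightarrow> (\<And>x. M (X x) = X (M x)) \<Longrightarrow> M (Y x) = Y (M x)"
proof -
  have "bounded_linear X"
    using bounded_clinearI[OF adjoint_pair_clinear[OF X] le] by (simp add: bounded_clinear_def)
  then obtain X' where X': "X = blinfun_apply X'"
    by (metis bounded_linear_Blinfun_apply)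
  have X'_le: "norm X' \<le> q" using le q by (intro norm_blinfun_bound) (auto simp: X')
  define commuting where
    "commuting = {M. bounded_linear M \<and> (\<forall>x. M (X x) = X (M x))}"
  define S where "S = {Y :: 'a \<Rightarrow>\<^sub>L 'a. norm Y \<le> q \<and>
    (\<forall>x y. cinner (blinfun_apply Y x) y = cinner x (blinfun_apply Y y)) \<and>
    (\<forall>M\<in>commuting. \<forall>x. M (blinfun_apply Y x) = blinfun_apply Y (M x))}"
  define F where "F Y = (1/2) *\<^sub>R (X' + (Y o\<^sub>L Y))" for Y
  \<comment> \<open>Norm limits converge pointwise, and each condition in \<open>S\<close> is
    preserved by pointwise limits.\<close>
  have "closed S"
    unfolding closed_sequential_limits
  proof (intro allI impI, elim conjE)
    fix s :: "nat \<Rightarrow> 'a \<Rightarrow>\<^sub>L 'a" and L assume s: "\<forall>n. s n \<in> S" and lim: "s \<longlonglongrightarrow> L"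
    have ap: "(\<lambda>n. s n x) \<longlonglongrightarrow> L x" for x
      by (intro tendsto_intros lim)
    have "norm L \<le> q"
      using LIMSEQ_le_const2[OF tendsto_norm[OF lim]] s by (auto simp: S_def)
    moreover have "cinner (L x) y = cinner x (L y)" for x y
    proof (rule LIMSEQ_unique)
      show "(\<lambda>n. cinner (s n x) y) \<longlonglongrightarrow> cinner (L x) y"
        by (rule bounded_linear.tendsto[OF bounded_linear_cinner_left ap])
      show "(\<lambda>n. cinner (s n x) y) \<longlonglongrightarrow> cinner x (L y)"
        using bounded_linear.tendsto[OF bounded_linear_cinner_right ap] s by (simp add: S_def)
    qed
    moreover have "M (L x) = L (M x)" if M: "M \<in> commuting" for M x
    proof (rule LIMSEQ_unique)
      show "(\<lambda>n. M (s n x)) \<longlonglongrightarrow> M (L x)"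
        using M by (intro bounded_linear.tendsto[OF _ ap]) (simp add: commuting_def)
      show "(\<lambda>n. M (s n x)) \<longlonglongrightarrow> L (M x)"
        using ap[of "M x"] s M by (simp add: S_def)
    qed
    ultimately show "L \<in> S" by (simp add: S_def)
  qed
  then have "complete S" by (simp add: complete_eq_closed)
  moreover have "0 \<in> S"
    using q by (auto simp: S_def commuting_def linear_0 bounded_linear.linear)
  moreover have "F Y \<in> S" if "Y \<in> S" for Y
  proof -
    have Y: "norm Y \<le> q" "\<And>x y. cinner (Y x) y = cinner x (Y y)"
      "\<And>M x. M \<in> commuting \<Longrightarrow> M (Y x) = Y (M x)"
      using that by (auto simp: S_def)
    \<comment> \<open>The norm of \<open>F Y\<close> is at most the mean of \<open>q\<close> and
      \<open>q * q\<close>, and \<open>q < 1\<close> brings this below \<open>q\<close>.\<close>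
    have "norm (Y o\<^sub>L Y) \<le> q * q"
      using norm_blinfun_compose[of Y Y] mult_mono[OF Y(1) Y(1)] q by simp
    also have "\<dots> \<le> q" using q by (simp add: mult_left_le)
    finally have "norm (F Y) \<le> q"
      using norm_triangle_ineq[of X' "Y o\<^sub>L Y"] X'_le by (simp add: F_def)
    moreover have "cinner (F Y x) y = cinner x (F Y y)" for x y
      using adjoint_pairD[OF X, of x y]
      by (simp add: F_def cinner_linear Y(2) X' blinfun.bilinear_simps)
    moreover have "M (F Y x) = F Y (M x)" if "M \<in> commuting" for M x
    proof -
      interpret M: bounded_linear M using that by (simp add: commuting_def)
      have "M (X' x) = X' (M x)" using that by (simp add: commuting_def X')
      then show ?thesis
        by (simp add: F_def M.scaleR M.add Y(3)[OF that] blinfun.bilinear_simps)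
    qed
    ultimately show ?thesis by (simp add: S_def)
  qed
  moreover have "dist (F Y) (F Z) \<le> q * dist Y Z" if "Y \<in> S" "Z \<in> S" for Y Z
  proof -
    \<comment> \<open>The difference of squares is telescoped without interchanging \<open>Y\<close>
      and \<open>Z\<close>; the factor 1/2 then makes the contraction constant exactly
      \<open>q\<close>.\<close>
    have "F Y - F Z = (1/2) *\<^sub>R (((Y - Z) o\<^sub>L Y) + (Z o\<^sub>L (Y - Z)))"
      by (rule blinfun_eqI) (simp add: F_def blinfun.bilinear_simps algebra_simps)
    then have "norm (F Y - F Z) \<le> (1/2) * (norm (Y - Z) * norm Y + norm Z * norm (Y - Z))"
      using norm_triangle_ineq[of "(Y - Z) o\<^sub>L Y" "Z o\<^sub>L (Y - Z)"]
        norm_blinfun_compose[of "Y - Z" Y] norm_blinfun_compose[of Z "Y - Z"] by simp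
    also have "\<dots> \<le> (1/2) * (norm (Y - Z) * q + q * norm (Y - Z))"
      using that by (intro mult_left_mono add_mono mult_right_mono) (auto simp: S_def)
    finally show ?thesis by (simp add: dist_norm)
  qed
  ultimately have "\<exists>!Y\<in>S. F Y = Y"
    using q by (intro Banach_fix) auto
  then obtain Y where Y: "Y \<in> S" "F Y = Y" by blast
  show thesis
  proof (rule that)
    show "adjoint_pair Y Y" using Y by (simp add: S_def adjoint_pair_def)
    show "norm (Y x) \<le> q * norm x" for x
      using Y norm_blinfun[of Y x] mult_right_mono[of "norm Y" q "norm x"] by (simp add: S_def)
    have "2 *\<^sub>R F Y x = X x + Y (Y x)" for x
      by (simp add: F_def X' blinfun.bilinear_simps)
    then show "2 *\<^sub>R Y x = X x + Y (Y x)" for x by (simp add: Y)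
    show "M (Y x) = Y (M x)" if "bounded_linear M" "\<And>x. M (X x) = X (M x)" for M x
      using Y that by (simp add: S_def commuting_def)
  qed
qed

text \<open>The root is \<open>I - Y\<close>: the bound \<open>q < 1\<close> on \<open>Y\<close>
  makes it coercive and bijective, and it inherits the bicommutant property. The last clause serves
  to recognise roots built by other means.\<close>

lemma op_sqrt_id_minus:
  fixes X :: "'a::complex_hilbert_space \<Rightarrow> 'a"
  assumes X: "adjoint_pair X X" and le: "\<And>x. norm (X x) \<le> q * norm x" and q: "0 \<le> q" "q < 1"
  defines "Q \<equiv> op_sqrt (\<lambda>x. x - X x)"
  shows "positive_op Q"
    and "adjoint_pair Q Q"
    and "Q (Q x) = x - X x"
    and "bij Q"
    and "(1 - q) * norm x \<le> norm (Q x)"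
    and "\<And>M. bounded_linear M \<Longrightarrow> (\<And>x. M (X x) = X (M x)) \<Longrightarrow> M (Q x) = Q (M x)"
    and "\<And>R. positive_op R \<Longrightarrow> (\<And>x. R (R x) = x - X x) \<Longrightarrow> R = Q"
proof -
  obtain Y where Y: "adjoint_pair Y Y" "\<And>x. norm (Y x) \<le> q * norm x"
    "\<And>x. 2 *\<^sub>R Y x = X x + Y (Y x)"
    "\<And>M x. bounded_linear M \<Longrightarrow> (\<And>x. M (X x) = X (M x)) \<Longrightarrow> M (Y x) = Y (M x)"
    using contraction_fixed_point[OF X le q] by blast
  have "bounded_clinear Y" by (rule bounded_clinearI[OF adjoint_pair_clinear[OF Y(1)] Y(2)])
  then interpret Y: bounded_linear Y by (simp add: bounded_clinear_def)
  define P where "P x = x - Y x" for x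
  have adj: "adjoint_pair P P"
    using Y(1) by (simp add: adjoint_pair_def P_def cinner_linear)
  have sq: "P (P x) = x - X x" for x
  proof -
    have "P (P x) = x - 2 *\<^sub>R Y x + Y (Y x)"
      by (simp add: P_def Y.diff scaleR_2)
    then show ?thesis by (simp add: Y(3))
  qed
  have P_le: "norm (P x) \<le> (1 + q) * norm x" for x
    using norm_triangle_ineq4[of x "Y x"] Y(2)[of x] by (simp add: P_def algebra_simps)
  have P: "bounded_clinear P" by (rule bounded_clinearI[OF adjoint_pair_clinear[OF adj] P_le])
  then interpret P: bounded_linear P by (simp add: bounded_clinear_def)
  \<comment> \<open>Cauchy-Schwarz bounds \<open>cinner (Y x) x\<close>. The estimate yields
    positivity of \<open>P\<close> and, below, uniqueness of the positive root.\<close>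
  have coercive: "(1 - q) * (norm x)\<^sup>2 \<le> Re (cinner (P x) x)" for x
  proof -
    have "Re (cinner (Y x) x) \<le> q * norm x * norm x"
      using Re_cinner_le[of "Y x" x] mult_right_mono[OF Y(2)[of x], of "norm x"] by simp
    then show ?thesis
      by (simp add: P_def cinner_diff_left cinner_self power2_eq_square algebra_simps
          del: of_real_power)
  qed
  have pos: "positive_op P"
    unfolding positive_op_def
  proof (intro conjI allI P)
    fix x
    have "cnj (cinner (P x) x) = cinner (P x) x"
      using cinner_commute[of "P x" x] adjoint_pairD[OF adj, of x x] by simp
    then have "Im (cinner (P x) x) = 0" by (simp add: complex_eq_iff)
    moreover have "0 \<le> (1 - q) * (norm x)\<^sup>2" using q by simp
    ultimately show "cinner (P x) x \<in> \<real>\<^sub>\<ge>\<^sub>0"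
      using coercive[of x] by (simp add: complex_nonneg_Reals_iff)
  qed
  have comm: "M (P x) = P (M x)" if M: "bounded_linear M" "\<And>x. M (X x) = X (M x)" for M x
    using Y(4)[OF M] by (simp add: P_def linear_diff[OF bounded_linear.linear[OF M(1)]])
  \<comment> \<open>For \<open>z = P x - R x\<close>, commutation gives \<open>\<langle>(P + R) z, z\<rangle> = \<langle>(P\<^sup>2 - R\<^sup>2) x, z\<rangle> = 0\<close>.\<close>
  have uniq: "R = P" if R: "positive_op R" "\<And>x. R (R x) = x - X x" for R
  proof
    fix x
    interpret R: bounded_linear R using R(1) by (simp add: positive_op_def bounded_clinear_def)
    \<comment> \<open>\<open>R\<close> commutes with its own square \<open>I - X\<close>, hence with
      \<open>X\<close>; \<open>comm\<close> then makes it commute with \<open>P\<close>.\<close>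
    have "R (X y) = X (R y)" for y
    proof -
      have "R (y - X y) = R y - X (R y)" unfolding R(2)[symmetric] ..
      then show ?thesis by (simp add: R.diff)
    qed
    then have RP: "R (P y) = P (R y)" for y by (intro comm R.bounded_linear_axioms)
    define z where "z = P x - R x"
    have "P z + R z = 0" by (simp add: z_def P.diff R.diff sq R(2) RP)
    then have "cinner (P z) z + cinner (R z) z = 0" by (simp flip: cinner_add_left)
    moreover have "0 \<le> Re (cinner (R z) z)"
      using R(1) by (simp add: positive_op_def complex_nonneg_Reals_iff)
    ultimately have "Re (cinner (P z) z) \<le> 0" by (simp add: complex_eq_iff)
    with coercive[of z] have "(1 - q) * (norm z)\<^sup>2 \<le> 0" by simp
    then have "z = 0" using q by (simp add: mult_le_0_iff)
    then show "R x = P x" by (simp add: z_def)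
  qed
  have "Q = P"
    unfolding Q_def op_sqrt_def
  proof (rule the_equality)
    show "positive_op P \<and> P \<circ> P = (\<lambda>x. x - X x)" using pos by (auto simp: sq)
    show "R = P" if "positive_op R \<and> R \<circ> R = (\<lambda>x. x - X x)" for R
      using that by (intro uniq) (auto simp: fun_eq_iff)
  qed
  show "positive_op Q" "adjoint_pair Q Q" "Q (Q x) = x - X x"
    using pos adj sq by (simp_all add: \<open>Q = P\<close>)
  show "M (Q x) = Q (M x)" if "bounded_linear M" "\<And>x. M (X x) = X (M x)" for M
    unfolding \<open>Q = P\<close> using that by (rule comm)
  show "R = Q" if "positive_op R" "\<And>x. R (R x) = x - X x" for R
    unfolding \<open>Q = P\<close> using that by (rule uniq)
  show "bij Q"
    using bij_id_minus_contraction[OF Y.bounded_linear_axioms Y(2) q]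
    by (simp add: \<open>Q = P\<close> P_def[abs_def])
  show "(1 - q) * norm x \<le> norm (Q x)"
    using norm_triangle_ineq2[of x "Y x"] Y(2)[of x]
    by (simp add: \<open>Q = P\<close> P_def algebra_simps)
qed

text \<open>Self-adjointness passes from the root to its inverse by substituting \<open>B x\<close>
  and \<open>B y\<close>; the lower bound on the root gives the bound \<open>1 / (1 - q)\<close> on
  the inverse.\<close>

lemma op_inv_sqrt_id_minus:
  fixes X :: "'a::complex_hilbert_space \<Rightarrow> 'a"
  assumes X: "adjoint_pair X X" and le: "\<And>x. norm (X x) \<le> q * norm x" and q: "0 \<le> q" "q < 1"
  defines "B \<equiv> op_inv_sqrt (\<lambda>x. x - X x)"
  shows "adjoint_pair B B"
    and "bounded_linear B"
    and "B (op_sqrt (\<lambda>x. x - X x) x) = x"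
    and "op_sqrt (\<lambda>x. x - X x) (B x) = x"
proof -
  define Q where "Q = op_sqrt (\<lambda>x. x - X x)"
  note Q = op_sqrt_id_minus[OF X le q, folded Q_def]
  have B: "B = inv Q" by (simp add: B_def Q_def op_inv_sqrt_def)
  have QB: "Q (B x) = x" for x
    using Q(4) by (simp add: B bij_is_surj surj_f_inv_f)
  have BQ: "B (Q x) = x" for x
    using Q(4) by (simp add: B bij_is_inj)
  show adj: "adjoint_pair B B"
    unfolding adjoint_pair_def using adjoint_pairD[OF Q(2), of "B _" "B _"] by (simp add: QB)
  have "norm (B x) \<le> (1 / (1 - q)) * norm x" for x
    using Q(5)[of "B x"] q by (simp add: QB field_simps)
  from bounded_clinearI[OF adjoint_pair_clinear[OF adj] this]
  show "bounded_linear B" by (simp add: bounded_clinear_def)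
  show "B (op_sqrt (\<lambda>x. x - X x) x) = x" "op_sqrt (\<lambda>x. x - X x) (B x) = x"
    using BQ QB by (simp_all add: Q_def)
qed

section \<open>Normality\<close>

text \<open>The Cayley step. \<open>P\<close> is given only through its product with the root
  \<open>Q\<close>, which determines it because \<open>Q\<close> is surjective; commutation is
  passed from the square of \<open>P\<close> to \<open>N\<close>, then to \<open>Q\<close>, then to
  \<open>P\<close>.\<close>

lemma commute_square_imp_commute:
  fixes N :: "'a::complex_hilbert_space \<Rightarrow> 'a"
  assumes N: "adjoint_pair N N" and le: "\<And>x. norm (N x) \<le> q * norm x" and q: "0 \<le> q" "q < 1"
    and P: "bounded_linear P"
    and PQ: "\<And>x. P (op_sqrt (\<lambda>x. x - N (N x)) x) = x + N x"
    and W: "bounded_linear W" and WPP: "\<And>x. W (P (P x)) = P (P (W x))"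
  shows "W (P x) = P (W x)"
proof -
  interpret P: bounded_linear P by fact
  interpret W: bounded_linear W by fact
  have blN: "bounded_linear N"
    using bounded_clinearI[OF adjoint_pair_clinear[OF N] le] by (simp add: bounded_clinear_def)
  then interpret N: bounded_linear N .
  define Q where "Q = op_sqrt (\<lambda>x. x - N (N x))"
  have NN: "adjoint_pair (\<lambda>x. N (N x)) (\<lambda>x. N (N x))"
    using adjoint_pair_comp[OF N N] by (simp add: o_def)
  \<comment> \<open>The weaker constant \<open>q\<close> in place of \<open>q * q\<close> lets one
    constant serve for \<open>N\<close> and its square.\<close>
  have NN_le: "norm (N (N x)) \<le> q * norm x" for x
    using le[of "N x"] mult_left_le_one_le[of "norm (N x)" q] le[of x] q by simp
  note Q = op_sqrt_id_minus[OF NN NN_le q, folded Q_def]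
  note PQ = PQ[folded Q_def]
  have NQ: "N (Q x) = Q (N x)" for x by (rule Q(6)[OF blN]) simp
  interpret Q: bounded_linear Q using Q(1) by (simp add: positive_op_def bounded_clinear_def)
  have exQ: "\<exists>y. x = Q y" for x using Q(4) by (metis bij_pointE)
  have QP: "Q (P x) = P (Q x)" for x
  proof -
    obtain y where "x = Q y" using exQ by blast
    then show ?thesis by (simp add: PQ Q.add NQ)
  qed
  have ex_minus: "\<exists>z. y = z - N z" for y
    using bij_id_minus_contraction[OF blN le q] by (metis bij_pointE)
  have ex_plus: "\<exists>z. y = z + N z" for y
  proof -
    have "bij (\<lambda>x. x - - N x)"
      by (rule bij_id_minus_contraction[OF bounded_linear_minus[OF blN] _ q]) (simp add: le)
    then show ?thesis by (simp add: bij_iff) metis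
  qed
  \<comment> \<open>The square of \<open>P\<close> is the Cayley transform of \<open>N\<close>.
    Writing \<open>y = z + N z\<close> turns \<open>y - N y\<close> into \<open>Q (Q z)\<close>,
    from which both copies of \<open>Q\<close> are absorbed.\<close>
  have PP: "P (P (y - N y)) = y + N y" for y
  proof -
    obtain z where y: "y = z + N z" using ex_plus by blast
    then have "y - N y = Q (Q z)" by (simp add: Q(3) N.add)
    then have "P (P (y - N y)) = P (Q (P (Q z)))" by (simp only: QP)
    then show ?thesis by (simp add: PQ y)
  qed
  have WN: "W (N y) = N (W y)" for y
  proof -
    \<comment> \<open>Write the commutator \<open>d\<close> as \<open>z - N z\<close>. Applying the
      Cayley transform shows that \<open>d\<close> is also \<open>- (z + N z)\<close>, so
      \<open>z = 0\<close>.\<close>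
    define d where "d = W (N y) - N (W y)"
    obtain z where z: "d = z - N z" using ex_minus by blast
    have "W y + W (N y) = P (P (W (y - N y)))"
      using WPP[of "y - N y"] by (simp add: PP W.add)
    also have "W (y - N y) = (W y - N (W y)) - d" by (simp add: d_def W.diff)
    also have "P (P \<dots>) = W y + N (W y) - (z + N z)"
      using PP[of "W y"] PP[of z] by (simp only: P.diff z)
    finally have "2 *\<^sub>R z = 0" using z by (simp add: d_def scaleR_2 algebra_simps)
    then show ?thesis using z by (simp add: d_def N.zero)
  qed
  have WQ: "W (Q y) = Q (W y)" for y
    by (rule Q(6)[OF W]) (simp add: WN)
  obtain y where "x = Q y" using exQ by blast
  then show ?thesis by (simp add: PQ WQ W.add WN)
qed

section \<open>Block-diagonal operators and products with a unitary\<close>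

lemma bounded_linear_map_prod:
  assumes "bounded_linear f" "bounded_linear g"
  shows "bounded_linear (map_prod f g)"
proof -
  have "map_prod f g = (\<lambda>z. (f (fst z), g (snd z)))" by auto
  then show ?thesis
    by (simp add: bounded_linear_Pair bounded_linear_compose[OF assms(1) bounded_linear_fst]
        bounded_linear_compose[OF assms(2) bounded_linear_snd])
qed

lemma positive_op_map_prod:
  assumes "positive_op f" "positive_op g"
  shows "positive_op (map_prod f g)"
  using assms bounded_linear_map_prod[of f g]
  by (auto simp: positive_op_def bounded_clinear_def clinear_iff cinner_prod_def scaleC_prod_def
      complex_nonneg_Reals_iff)

text \<open>For \<open>T = P \<circ> W\<close>, the product of \<open>T\<close> with its adjoint is
  \<open>P \<circ> P\<close>, and in the other order it is
  \<open>W' \<circ> P \<circ> P \<circ> W\<close>; multiplying by \<open>W\<close> turns equality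
  into commutation.\<close>

lemma normal_op_comp_unitary_iff:
  assumes P: "adjoint_pair P P" "bounded_linear P"
    and W: "adjoint_pair W W'" "bounded_linear W" "W \<circ> W' = id" "W' \<circ> W = id"
  shows "normal_op (P \<circ> W) \<longleftrightarrow> (\<forall>x. W (P (P x)) = P (P (W x)))"
proof -
  have WW': "W (W' x) = x" "W' (W x) = x" for x
    using W(3,4) by (simp_all add: fun_eq_iff)
  have adj: "adjoint_pair (P \<circ> W) (W' \<circ> P)" by (rule adjoint_pair_comp[OF P(1) W(1)])
  have "bounded_clinear (P \<circ> W)"
    using adjoint_pair_clinear[OF adj] bounded_linear_compose[OF P(2) W(2)]
    by (simp add: bounded_clinear_def o_def)
  then have "normal_op (P \<circ> W) \<longleftrightarrow> (\<forall>x. P (P x) = W' (P (P (W x))))"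
    by (simp add: normal_op_def cadjoint_eqI[OF adj] fun_eq_iff WW')
  also have "\<dots> \<longleftrightarrow> (\<forall>x. W (P (P x)) = P (P (W x)))"
    by (metis WW')
  finally show ?thesis .
qed

theorem proposition1p1:
  fixes A C :: "'k::complex_hilbert_space \<Rightarrow> 'h::complex_hilbert_space"
    and B U :: "'h \<Rightarrow> 'h"
    and E V :: "'k \<Rightarrow> 'k"
    and T :: "'h \<times> 'k \<Rightarrow> 'h \<times> 'k"
  assumes "\<forall>(M :: 'h set) (N :: 'k set).
      orthonormal_basis M \<and> orthonormal_basis N \<longrightarrow> \<not> M \<approx> N"
    and "A \<in> operator_ball"
    and "U \<in> unitary_group"
    and "V \<in> unitary_group"
    and "B = op_inv_sqrt (\<lambda>h. h - A (cadjoint A h))"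
    and "C = op_inv_sqrt (\<lambda>h. h - A (cadjoint A h)) \<circ> A"
    and "E = op_inv_sqrt (\<lambda>k. k - cadjoint A (A k))"
    and "T = block_op (B \<circ> U) (C \<circ> V) (cadjoint C \<circ> U) (E \<circ> V)"
    and "T \<in> form_group"
  shows "normal_op T \<longleftrightarrow> U \<circ> B = B \<circ> U \<and> U \<circ> C = C \<circ> V \<and> V \<circ> E = E \<circ> V"
proof -
  define A' where "A' = cadjoint A"
  define q where "q = onorm A"
  have bcA: "bounded_clinear A" and q1: "q < 1"
    using assms(2) by (auto simp: operator_ball_def q_def)
  then have blA: "bounded_linear A" by (simp add: bounded_clinear_def)
  have q0: "0 \<le> q" unfolding q_def by (rule onorm_pos_le[OF blA])
  have A_le: "norm (A x) \<le> q * norm x" for x unfolding q_def by (rule onorm[OF blA])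
  have A: "adjoint_pair A A'" unfolding A'_def by (rule adjoint_pair_cadjoint[OF bcA])
  note A' = adjoint_pair_sym[OF A]
  have A'_le: "norm (A' y) \<le> q * norm y" for y by (rule adjoint_pair_norm_le[OF A A_le q0])
  have blA': "bounded_linear A'"
    using bounded_clinearI[OF adjoint_pair_clinear[OF A'] A'_le] by (simp add: bounded_clinear_def)

  \<comment> \<open>The off-diagonal self-adjoint contraction\<close>
  define N where "N = (\<lambda>z. (A (snd z), A' (fst z)))"
  have N: "adjoint_pair N N"
    using adjoint_pairD[OF A] adjoint_pairD[OF A']
    by (simp add: adjoint_pair_def N_def cinner_prod_def)
  have blN: "bounded_linear N"
    unfolding N_def
    by (intro bounded_linear_Pair bounded_linear_compose[OF blA] bounded_linear_compose[OF blA']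
        bounded_linear_fst bounded_linear_snd)
  have N_le: "norm (N z) \<le> q * norm z" for z
  proof (rule power2_le_imp_le)
    have "(norm (N z))\<^sup>2 = (norm (A (snd z)))\<^sup>2 + (norm (A' (fst z)))\<^sup>2"
      by (simp add: N_def norm_prod_def)
    also have "\<dots> \<le> (q * norm (snd z))\<^sup>2 + (q * norm (fst z))\<^sup>2"
      by (intro add_mono power_mono A_le A'_le) auto
    also have "\<dots> = (q * norm z)\<^sup>2"
      by (simp add: norm_prod_def power_mult_distrib algebra_simps)
    finally show "(norm (N z))\<^sup>2 \<le> (q * norm z)\<^sup>2" .
  qed (use q0 in simp)

  have AA'_adj: "adjoint_pair (\<lambda>h. A (A' h)) (\<lambda>h. A (A' h))"
    using adjoint_pair_comp[OF A A'] by (simp add: o_def)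
  have A'A_adj: "adjoint_pair (\<lambda>k. A' (A k)) (\<lambda>k. A' (A k))"
    using adjoint_pair_comp[OF A' A] by (simp add: o_def)
  have NN_adj: "adjoint_pair (\<lambda>z. N (N z)) (\<lambda>z. N (N z))"
    using adjoint_pair_comp[OF N N] by (simp add: o_def)
  have AA'_le: "norm (A (A' h)) \<le> q * norm h" for h
    using A_le[of "A' h"] A'_le[of h] mult_left_le_one_le[of "norm (A' h)" q] q0 q1 by simp
  have A'A_le: "norm (A' (A k)) \<le> q * norm k" for k
    using A'_le[of "A k"] A_le[of k] mult_left_le_one_le[of "norm (A k)" q] q0 q1 by simp
  have NN_le: "norm (N (N z)) \<le> q * norm z" for z
    using N_le[of "N z"] N_le[of z] mult_left_le_one_le[of "norm (N z)" q] q0 q1 by simp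

  \<comment> \<open>Block form of the square root and the intertwining relation\<close>
  define QH where "QH = op_sqrt (\<lambda>h. h - A (A' h))"
  define QK where "QK = op_sqrt (\<lambda>k. k - A' (A k))"
  define Q where "Q = op_sqrt (\<lambda>z. z - N (N z))"
  note QH = op_sqrt_id_minus[OF AA'_adj AA'_le q0 q1, folded QH_def]
  note QK = op_sqrt_id_minus[OF A'A_adj A'A_le q0 q1, folded QK_def]
  note Q = op_sqrt_id_minus[OF NN_adj NN_le q0 q1, folded Q_def]
  have B_def: "B = op_inv_sqrt (\<lambda>h. h - A (A' h))" using assms(5) by (simp add: A'_def)
  have E_def: "E = op_inv_sqrt (\<lambda>k. k - A' (A k))" using assms(7) by (simp add: A'_def)
  have C_def: "C = B \<circ> A" using assms(5,6) by simp
  note B = op_inv_sqrt_id_minus[OF AA'_adj AA'_le q0 q1, folded QH_def B_def]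
  note E = op_inv_sqrt_id_minus[OF A'A_adj A'A_le q0 q1, folded QK_def E_def]

  \<comment> \<open>The square of \<open>N\<close> is block diagonal with entries
    \<open>A \<circ> A'\<close> and \<open>A' \<circ> A\<close>, so \<open>QH\<close> and
    \<open>QK\<close> together form a positive root, and uniqueness identifies it with
    \<open>Q\<close>.\<close>
  have Q_eq: "map_prod QH QK = Q"
  proof (rule Q(7))
    show "positive_op (map_prod QH QK)" by (rule positive_op_map_prod[OF QH(1) QK(1)])
    show "map_prod QH QK (map_prod QH QK z) = z - N (N z)" for z
      by (cases z) (simp add: QH(3) QK(3) N_def)
  qed
  \<comment> \<open>The upper off-diagonal block of this identity moves \<open>A\<close> past the
    roots; inverting both roots gives \<open>BA\<close>.\<close>
  have "N (Q z) = Q (N z)" for z by (rule Q(6)[OF blN]) simp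
  from this[of "(0, _)"] have AQ: "A (QK k) = QH (A k)" for k
    by (simp add: N_def flip: Q_eq)
  have BA: "B (A k) = A (E k)" for k
    using AQ[of "E k"] B(3)[of "A (E k)"] by (simp add: E(4))

  \<comment> \<open>The self-adjoint factor of \<open>T\<close>\<close>
  have C_adj: "adjoint_pair C (A' \<circ> B)"
    unfolding C_def by (rule adjoint_pair_comp[OF B(1) A])
  have cadjC: "cadjoint C = A' \<circ> B" by (rule cadjoint_eqI[OF C_adj])
  define P where "P = block_op B C (cadjoint C) E"
  have P_adj: "adjoint_pair P P"
    using adjoint_pairD[OF B(1)] adjoint_pairD[OF E(1)] adjoint_pairD[OF C_adj]
      adjoint_pairD[OF adjoint_pair_sym[OF C_adj]]
    by (auto simp: adjoint_pair_def P_def block_op_def cadjC cinner_prod_def cinner_linear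
        split: prod.splits)
  \<comment> \<open>\<open>P\<close> is \<open>I + N\<close> after the diagonal of \<open>B\<close>
    and \<open>E\<close>; the upper right block needs \<open>BA\<close> to rewrite
    \<open>A \<circ> E\<close> as \<open>C\<close>.\<close>
  have P_eq: "P z = map_prod B E z + N (map_prod B E z)" for z
    unfolding P_def cadjC by (cases z) (simp add: block_op_def C_def N_def BA add.commute)
  have blBE: "bounded_linear (map_prod B E)" by (rule bounded_linear_map_prod[OF B(2) E(2)])
  have blP: "bounded_linear P"
    unfolding P_eq[abs_def]
    by (intro bounded_linear_add blBE bounded_linear_compose[OF blN blBE])
  have PQ: "P (Q z) = z + N z" for z
    by (cases z) (simp add: P_eq B(3) E(3) flip: Q_eq)

  \<comment> \<open>The unitary factor and the normality criterion\<close>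
  define U' where "U' = cadjoint U"
  define V' where "V' = cadjoint V"
  have U: "bounded_clinear U" "U' \<circ> U = id" "U \<circ> U' = id"
    and V: "bounded_clinear V" "V' \<circ> V = id" "V \<circ> V' = id"
    using assms(3,4) by (simp_all add: unitary_group_def U'_def V'_def)
  have U_adj: "adjoint_pair U U'" and V_adj: "adjoint_pair V V'"
    unfolding U'_def V'_def by (intro adjoint_pair_cadjoint U(1) V(1))+
  define W where "W = map_prod U V"
  have W_adj: "adjoint_pair W (map_prod U' V')"
    unfolding W_def by (rule adjoint_pair_map_prod[OF U_adj V_adj])
  have blW: "bounded_linear W"
    unfolding W_def using U(1) V(1)
    by (intro bounded_linear_map_prod) (simp_all add: bounded_clinear_def)
  have WW: "W \<circ> map_prod U' V' = id" "map_prod U' V' \<circ> W = id"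
    by (simp_all add: W_def map_prod.comp U V map_prod.id)
  have T_eq: "T = P \<circ> W"
    by (auto simp: assms(8) P_def W_def block_op_def)

  have "normal_op T \<longleftrightarrow> (\<forall>z. W (P (P z)) = P (P (W z)))"
    unfolding T_eq by (rule normal_op_comp_unitary_iff[OF P_adj blP W_adj blW WW])
  \<comment> \<open>From right to left, commutation with \<open>P\<close> is applied twice; the
    other direction is the Cayley argument.\<close>
  also have "\<dots> \<longleftrightarrow> (\<forall>z. W (P z) = P (W z))"
    using commute_square_imp_commute[OF N N_le q0 q1 blP PQ[unfolded Q_def] blW] by metis
  also have "\<dots> \<longleftrightarrow> U \<circ> B = B \<circ> U \<and> U \<circ> C = C \<circ> V \<and> V \<circ> E = E \<circ> V"
  proof -
    have add: "U (x + y) = U x + U y" "V (w + v) = V w + V v" for x y w v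
      using U(1) V(1) by (simp_all add: bounded_clinear_def clinear_iff)
    have zero: "U 0 = 0" "V 0 = 0" "B 0 = 0" "E 0 = 0" "A 0 = 0" "A' 0 = 0"
      using U(1) V(1) B(2) E(2) blA blA'
      by (simp_all add: bounded_clinear_def linear_0 bounded_linear.linear)
    show ?thesis
    proof
      assume com: "\<forall>z. W (P z) = P (W z)"
      \<comment> \<open>Vectors \<open>(h, 0)\<close> and \<open>(0, k)\<close> isolate the two
        columns of the block identity.\<close>
      have "U (B h) = B (U h)" for h
        using com[rule_format, of "(h, 0)"]
        unfolding P_def cadjC by (simp add: W_def block_op_def C_def zero)
      moreover have "U (C k) = C (V k)" "V (E k) = E (V k)" for k
        using com[rule_format, of "(0, k)"]
        unfolding P_def cadjC by (simp_all add: W_def block_op_def C_def zero)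
      ultimately show "U \<circ> B = B \<circ> U \<and> U \<circ> C = C \<circ> V \<and> V \<circ> E = E \<circ> V"
        by (simp add: fun_eq_iff)
    next
      assume "U \<circ> B = B \<circ> U \<and> U \<circ> C = C \<circ> V \<and> V \<circ> E = E \<circ> V"
      then have UB: "U \<circ> B = B \<circ> U" and UC: "U \<circ> C = C \<circ> V" and VE: "V \<circ> E = E \<circ> V"
        by auto
      \<comment> \<open>The lower left block requires
        \<open>V \<circ> cadjoint C = cadjoint C \<circ> U\<close>: take adjoints in
        \<open>UC\<close>, then multiply by \<open>V\<close> on the left and \<open>U\<close> on the
        right.\<close>
      have "cadjoint C \<circ> U' = V' \<circ> cadjoint C"
        using cadjoint_eqI[OF adjoint_pair_comp[OF U_adj C_adj]]
          cadjoint_eqI[OF adjoint_pair_comp[OF C_adj V_adj]] by (simp add: UC cadjC)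
      then have "V \<circ> (cadjoint C \<circ> U') \<circ> U = V \<circ> (V' \<circ> cadjoint C) \<circ> U" by simp
      then have VC: "V \<circ> cadjoint C = cadjoint C \<circ> U"
        using U(2) V(3) by (simp add: fun_eq_iff)
      show "\<forall>z. W (P z) = P (W z)"
        using UB UC VE VC by (simp add: W_def P_def block_op_def add fun_eq_iff)
    qed
  qed
  finally show ?thesis .
qed

end
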